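(* Let $k$ and $n$ be positive integers with $n > (k+1)^2$. If $\mathcal{L}$ is a set of $k$-MOLS$(n)$, then $c(G(\mathcal{L})) = k+2$.
   Context: A latin square of order $n$ is an $n\times n$ array with entries from a set of $n$ symbols (taken to be $[n]=\{1,\dots,n\}$) such that each symbol occurs exactly once in each row and in each column. Two latin squares $A,B$ of order $n$ are orthogonal if the $n^2$ pairs $(A[i,j],B[i,j])$ are distinct. A set of $k$-MOLS$(n)$ is a set of $k$ pairwise orthogonal latin squares of order $n$ (for $k=1$, a single latin square). The latin square graph $G(\mathcal{L})$ of a set $\mathcal{L}$ of $k$-MOLS$(n)$ is the graph whose $n^2$ vertices are the cells $(i,j)\in[n]\times[n]$, where two distinct cells are adjacent if they share a row, share a column, or contain the same symbol in at least one of the $k$ latin squares. Cops and Robbers on a graph $G$: first the cops choose vertices, then the robber chooses a vertex; thereafter the cops and the robber alternate turns, and on a turn each player moves to an adjacent vertex or stays put. All positions are visible to everyone. The cops win if after finitely many rounds some cop lands on the robber's vertex; otherwise the robber wins. The cop number $c(G)$ is the least number of cops for which the cops have a winning strategy. *)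

theory Defs
  imports "Graph_Theory.Pair_Digraph"
begin

text \<open>
  A square of order \<open>n\<close> is a function on cells of which only the values on
  \<open>{1..n} \<times> {1..n}\<close> matter.
\<close>

definition latin_square :: "nat \<Rightarrow> (nat \<Rightarrow> nat \<Rightarrow> nat) \<Rightarrow> bool" where
  "latin_square n A \<longleftrightarrow>
     (\<forall>i\<in>{1..n}. \<forall>j\<in>{1..n}. A i j \<in> {1..n}) \<and>
     (\<forall>s\<in>{1..n}. \<forall>i\<in>{1..n}. \<exists>!j. j \<in> {1..n} \<and> A i j = s) \<and>
     (\<forall>s\<in>{1..n}. \<forall>j\<in>{1..n}. \<exists>!i. i \<in> {1..n} \<and> A i j = s)"

definition orthogonal_squares ::
  "nat \<Rightarrow> (nat \<Rightarrow> nat \<Rightarrow> nat) \<Rightarrow> (nat \<Rightarrow> nat \<Rightarrow> nat) \<Rightarrow> bool" where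
  "orthogonal_squares n A B \<longleftrightarrow> inj_on (\<lambda>(i, j). (A i j, B i j)) ({1..n} \<times> {1..n})"

text \<open>
  For \<open>n \<ge> 2\<close> a latin square is not orthogonal to itself, so two distinct elements of
  a set of MOLS already differ on a cell of \<open>{1..n} \<times> {1..n}\<close>; hence \<open>card Ls\<close> counts arrays
  even though values outside the cells are unconstrained.
\<close>

definition is_MOLS :: "nat \<Rightarrow> nat \<Rightarrow> (nat \<Rightarrow> nat \<Rightarrow> nat) set \<Rightarrow> bool" where
  "is_MOLS k n Ls \<longleftrightarrow>
     finite Ls \<and> card Ls = k \<and> (\<forall>A\<in>Ls. latin_square n A) \<and>
     pairwise (orthogonal_squares n) Ls"

text \<open>Undirected simple graphs are represented by symmetric loop-free pair digraphs.\<close>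

definition latin_square_graph ::
  "nat \<Rightarrow> (nat \<Rightarrow> nat \<Rightarrow> nat) set \<Rightarrow> (nat \<times> nat) pair_pre_digraph" where
  "latin_square_graph n Ls =
     \<lparr> pverts = {1..n} \<times> {1..n},
       parcs = {((i, j), (i', j')).
          (i, j) \<in> {1..n} \<times> {1..n} \<and> (i', j') \<in> {1..n} \<times> {1..n} \<and> (i, j) \<noteq> (i', j') \<and>
          (i = i' \<or> j = j' \<or> (\<exists>A\<in>Ls. A i j = A i' j'))} \<rparr>"

lemma pair_graph_latin_square_graph: "pair_graph (latin_square_graph n Ls)"
proof
  show "symmetric (with_proj (latin_square_graph n Ls))"
    unfolding symmetric_def with_proj_simps
    by (rule symI) (auto simp: latin_square_graph_def dest: sym)
next
  show "finite (parcs (latin_square_graph n Ls))"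
    by (rule finite_subset[of _ "({1..n} \<times> {1..n}) \<times> ({1..n} \<times> {1..n})"])
      (auto simp: latin_square_graph_def)
qed (auto simp: latin_square_graph_def)

definition legal_step :: "'a pair_pre_digraph \<Rightarrow> 'a \<Rightarrow> 'a \<Rightarrow> bool" where
  "legal_step G u v \<longleftrightarrow> u = v \<or> (u, v) \<in> parcs G"

text \<open>
  \<open>r t\<close> is the robber's vertex after his \<open>t\<close>-th move, \<open>r 0\<close> being his initial choice. As he may
  always stay put, considering only infinite plays loses nothing.
\<close>

definition robber_play :: "'a pair_pre_digraph \<Rightarrow> (nat \<Rightarrow> 'a) \<Rightarrow> bool" where
  "robber_play G r \<longleftrightarrow> r 0 \<in> pverts G \<and> (\<forall>t. legal_step G (r t) (r (Suc t)))"

text \<open>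
  A cop strategy maps the list of all robber positions so far to the list of cop positions, one
  entry per cop; several cops may share a vertex. The cops' own earlier positions are
  determined by the strategy and the earlier robber positions, so this covers all
  history-dependent strategies. \<open>cops_at s r t\<close> is the position the robber sees when choosing
  \<open>r t\<close>, and \<open>cops_at s r (Suc t)\<close> is the cops' reply to it.
\<close>

definition cops_at :: "('a list \<Rightarrow> 'a list) \<Rightarrow> (nat \<Rightarrow> 'a) \<Rightarrow> nat \<Rightarrow> 'a list" where
  "cops_at s r t = s (map r [0..<t])"

definition cop_strategy ::
  "'a pair_pre_digraph \<Rightarrow> nat \<Rightarrow> ('a list \<Rightarrow> 'a list) \<Rightarrow> bool" where
  "cop_strategy G m s \<longleftrightarrow>
     length (s []) = m \<and> set (s []) \<subseteq> pverts G \<and>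
     (\<forall>r. robber_play G r \<longrightarrow>
        (\<forall>t. list_all2 (legal_step G) (cops_at s r t) (cops_at s r (Suc t))))"

text \<open>
  The first disjunct is the robber stepping onto (or starting at) a cop's vertex, the second a cop
  moving onto the robber's vertex. Play formally goes on after a capture, which is harmless.
\<close>

definition captured :: "('a list \<Rightarrow> 'a list) \<Rightarrow> (nat \<Rightarrow> 'a) \<Rightarrow> nat \<Rightarrow> bool" where
  "captured s r t \<longleftrightarrow> r t \<in> set (cops_at s r t) \<or> r t \<in> set (cops_at s r (Suc t))"

definition cops_win :: "'a pair_pre_digraph \<Rightarrow> nat \<Rightarrow> bool" where
  "cops_win G m \<longleftrightarrow>
     (\<exists>s. cop_strategy G m s \<and> (\<forall>r. robber_play G r \<longrightarrow> (\<exists>t. captured s r t)))"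

text \<open>
  On a finite graph the set of winning numbers of cops is nonempty (take one cop per vertex),
  so \<open>LEAST\<close> is meaningful.
\<close>

definition cop_number :: "'a pair_pre_digraph \<Rightarrow> nat" where
  "cop_number G = (LEAST m. cops_win G m)"

lemma cops_win_card_verts:
  assumes "finite (pverts G)"
  shows "cops_win G (card (pverts G))"
proof -
  obtain vs where vs: "set vs = pverts G" "distinct vs"
    using finite_distinct_list[OF assms] by blast
  have "cop_strategy G (card (pverts G)) (\<lambda>_. vs)"
    using vs distinct_card[of vs]
    by (auto simp: cop_strategy_def cops_at_def legal_step_def list_all2_same)
  moreover have "\<exists>t. captured (\<lambda>_. vs) r t" if "robber_play G r" for r
    using that vs by (auto simp: captured_def cops_at_def robber_play_def)
  ultimately show ?thesis
    unfolding cops_win_def by blast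
qed

end

theory Submission
  imports Defs
begin

text \<open>
  The cells with the rows, columns and symbol classes form a net: \<open>k + 2\<close> parallel classes of
  \<open>n\<close> lines with \<open>n\<close> points each, lines of different classes meeting in exactly one point.

  With \<open>k + 2\<close> cops, one per class, the cops move onto the \<open>k + 2\<close> lines through the robber's
  initial vertex, one onto each. Wherever the robber goes next, he is on a line with a cop and is
  captured.

  With at most \<open>k + 1\<close> cops and an uncaptured robber at \<open>v\<close>, some line \<open>L\<close> through \<open>v\<close> contains no
  cop, as a vertex other than \<open>v\<close> is on at most one line through \<open>v\<close>. Every cop is adjacent to at
  most \<open>k + 1\<close> points of \<open>L\<close>, one for each class other than that of \<open>L\<close>. Since
  \<open>(k + 1)\<^sup>2 < n\<close>, the robber can move to a point of \<open>L\<close> that no cop can reach.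
\<close>

section \<open>Cops and Robbers on an arbitrary graph\<close>

lemma legal_step_in_verts:
  assumes "parcs G \<subseteq> pverts G \<times> pverts G" and "legal_step G u v" and "u \<in> pverts G"
  shows "v \<in> pverts G"
  using assms by (auto simp: legal_step_def)

lemma robber_play_in_verts:
  assumes "parcs G \<subseteq> pverts G \<times> pverts G" and "robber_play G r"
  shows "r t \<in> pverts G"
proof (induction t)
  case 0
  then show ?case using assms(2) by (simp add: robber_play_def)
next
  case (Suc t)
  then show ?case
    using assms legal_step_in_verts[of G "r t" "r (Suc t)"] by (simp add: robber_play_def)
qed

lemma cops_at_length_in_verts:
  assumes "parcs G \<subseteq> pverts G \<times> pverts G" and "cop_strategy G m s" and "robber_play G r"
  shows "length (cops_at s r t) = m \<and> set (cops_at s r t) \<subseteq> pverts G"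
proof (induction t)
  case 0
  then show ?case using assms(2) by (simp add: cop_strategy_def cops_at_def)
next
  case (Suc t)
  have *: "list_all2 (legal_step G) (cops_at s r t) (cops_at s r (Suc t))"
    using assms(2,3) by (simp add: cop_strategy_def)
  have "set (cops_at s r (Suc t)) \<subseteq> pverts G"
  proof
    fix y assume "y \<in> set (cops_at s r (Suc t))"
    then obtain x where "x \<in> set (cops_at s r t)" "legal_step G x y"
      using * by (metis list_all2_conv_all_nth in_set_conv_nth)
    then show "y \<in> pverts G"
      using legal_step_in_verts[OF assms(1)] Suc.IH by blast
  qed
  then show ?case
    using * Suc.IH by (simp add: list_all2_lengthD[symmetric])
qed

text \<open>A robber who reacts to the cops needs only his own past vertices, since these determine
  the cops' positions. Growing that list makes course-of-values recursion structural.\<close>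

fun history :: "('a list \<Rightarrow> 'a) \<Rightarrow> nat \<Rightarrow> 'a list" where
  "history f 0 = []"
| "history f (Suc t) = history f t @ [f (history f t)]"

lemma history_eq_map: "history f t = map (\<lambda>i. f (history f i)) [0..<t]"
  by (induction t) auto

text \<open>The invariant is that after each robber move no cop can step onto his vertex. Then the
  cops' reply misses him, and \<open>escape\<close> restores the invariant.\<close>

lemma not_cops_win_if_escape:
  assumes arcs: "parcs G \<subseteq> pverts G \<times> pverts G"
    and start: "\<And>cs. length cs = m \<Longrightarrow> set cs \<subseteq> pverts G \<Longrightarrow>
      \<exists>v\<in>pverts G. \<forall>c\<in>set cs. \<not> legal_step G c v"
    and escape: "\<And>cs v. length cs = m \<Longrightarrow> set cs \<subseteq> pverts G \<Longrightarrow> v \<in> pverts G \<Longrightarrow> v \<notin> set cs \<Longrightarrow>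
      \<exists>w. legal_step G v w \<and> (\<forall>c\<in>set cs. \<not> legal_step G c w)"
  shows "\<not> cops_win G m"
proof
  assume "cops_win G m"
  then obtain s where s: "cop_strategy G m s" and win: "\<And>r. robber_play G r \<Longrightarrow> \<exists>t. captured s r t"
    unfolding cops_win_def by blast
  define safe where "safe xs v \<longleftrightarrow> (\<forall>c\<in>set (s xs). \<not> legal_step G c v)" for xs v
  \<comment> \<open>Staying put when there is no escape makes \<open>r\<close> a legal play before the cops are known to
    obey the rules against it.\<close>
  define f where "f xs =
    (if xs = [] then SOME v. v \<in> pverts G \<and> safe [] v
     else if \<exists>w. legal_step G (last xs) w \<and> safe xs w
     then SOME w. legal_step G (last xs) w \<and> safe xs w else last xs)" for xs
  define r where "r t = f (history f t)" for t
  have hist: "history f t = map r [0..<t]" for t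
    using history_eq_map[of f t] by (simp add: r_def)
  have cops: "cops_at s r t = s (history f t)" for t
    by (simp add: cops_at_def hist)
  have s0: "length (s []) = m" "set (s []) \<subseteq> pverts G"
    using s by (auto simp: cop_strategy_def)
  have "r 0 \<in> pverts G \<and> safe [] (r 0)"
    using start[OF s0] someI_ex[of "\<lambda>v. v \<in> pverts G \<and> safe [] v"]
    by (simp add: r_def f_def safe_def) blast
  then have r0: "r 0 \<in> pverts G" "safe [] (r 0)" by auto
  have last: "history f (Suc t) \<noteq> []" "last (history f (Suc t)) = r t" for t
    by (simp_all add: r_def)
  have r_Suc: "r (Suc t) = (if \<exists>w. legal_step G (r t) w \<and> safe (history f (Suc t)) w
     then SOME w. legal_step G (r t) w \<and> safe (history f (Suc t)) w else r t)" for t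
    unfolding r_def[of "Suc t"] f_def[of "history f (Suc t)"] last by (simp only: last if_False)
  have some: "legal_step G (r t) (r (Suc t)) \<and> safe (history f (Suc t)) (r (Suc t))"
    if "\<exists>w. legal_step G (r t) w \<and> safe (history f (Suc t)) w" for t
    using someI_ex[OF that] that by (simp only: r_Suc if_True)
  have "legal_step G (r t) (r (Suc t))" for t
    by (metis some r_Suc legal_step_def)
  then have play: "robber_play G r"
    using r0 by (simp add: robber_play_def)
  have avoid: "r t \<notin> set (cops_at s r (Suc t))" if "safe (history f t) (r t)" for t
  proof
    assume "r t \<in> set (cops_at s r (Suc t))"
    moreover have "list_all2 (legal_step G) (cops_at s r t) (cops_at s r (Suc t))"
      using s play by (simp add: cop_strategy_def)
    ultimately obtain c where "c \<in> set (cops_at s r t)" "legal_step G c (r t)"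
      by (metis list_all2_conv_all_nth in_set_conv_nth)
    then show False
      using that by (simp add: safe_def cops)
  qed
  have safe: "safe (history f t) (r t)" for t
  proof (induction t)
    case 0
    then show ?case using r0 by simp
  next
    case (Suc t)
    have "\<exists>w. legal_step G (r t) w \<and> safe (history f (Suc t)) w"
      using escape[of "cops_at s r (Suc t)" "r t"] avoid[OF Suc] robber_play_in_verts[OF arcs play]
        cops_at_length_in_verts[OF arcs s play, of "Suc t"]
      unfolding safe_def cops by blast
    then show ?case using some by blast
  qed
  \<comment> \<open>Safety also rules out the robber stepping onto a cop, because staying put is a
    legal step.\<close>
  have "\<not> captured s r t" for t
    using safe[of t] avoid[OF safe, of t]
    by (auto simp: captured_def cops[of t] safe_def legal_step_def)
  then show False
    using win[OF play] by blast
qed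

text \<open>The first move answers the robber's start so that every vertex he can go to next is
  within reach of a cop; the second move captures.\<close>

lemma cops_win_if_two_moves:
  assumes start: "length cs = m" "set cs \<subseteq> pverts G"
    and approach: "\<And>v. v \<in> pverts G \<Longrightarrow> \<exists>ds. list_all2 (legal_step G) cs ds \<and>
      (\<forall>w. legal_step G v w \<longrightarrow> (\<exists>d\<in>set ds. legal_step G d w))"
  shows "cops_win G m"
proof -
  obtain near where near: "\<And>v. v \<in> pverts G \<Longrightarrow> list_all2 (legal_step G) cs (near v) \<and>
      (\<forall>w. legal_step G v w \<longrightarrow> (\<exists>d\<in>set (near v). legal_step G d w))"
    using approach by metis
  define final where "final v w = map (\<lambda>d. if legal_step G d w then w else d) (near v)" for v w
  \<comment> \<open>Only the first two robber vertices are read, so the cops stand still after the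
    second move and remain legal for ever.\<close>
  define s where "s xs = (case xs of [] \<Rightarrow> cs | [v] \<Rightarrow> near v | v # w # _ \<Rightarrow> final v w)" for xs
  have at0: "cops_at s r 0 = cs" and at1: "cops_at s r (Suc 0) = near (r 0)"
    and at2: "cops_at s r (Suc (Suc t)) = final (r 0) (r 1)" for r t
    by (simp_all add: cops_at_def s_def upt_conv_Cons del: upt_Suc)
  have "list_all2 (legal_step G) (cops_at s r t) (cops_at s r (Suc t))" if "robber_play G r" for r t
  proof -
    have r0: "r 0 \<in> pverts G" using that by (simp add: robber_play_def)
    consider "t = 0" | "t = 1" | u where "t = Suc (Suc u)"
      by (metis One_nat_def not0_implies_Suc)
    then show ?thesis
    proof cases
      case 1
      then show ?thesis using near[OF r0] by (simp add: at0 at1)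
    next
      case 2
      then show ?thesis
        using at2[of r 0] by (simp add: at1 final_def list_all2_conv_all_nth legal_step_def)
    next
      case 3
      then show ?thesis by (simp only: at2) (simp add: list_all2_same legal_step_def)
    qed
  qed
  then have "cop_strategy G m s"
    using start by (simp add: cop_strategy_def s_def)
  moreover have "captured s r 1" if "robber_play G r" for r
  proof -
    have "r 0 \<in> pverts G" "legal_step G (r 0) (r 1)"
      using that by (auto simp: robber_play_def)
    then obtain d where "d \<in> set (near (r 0))" "legal_step G d (r 1)"
      using near by blast
    then show ?thesis
      by (force simp: captured_def at2 final_def)
  qed
  ultimately show ?thesis
    unfolding cops_win_def by blast
qed

section \<open>Nets: parallel classes of lines\<close>

text \<open>
  The line of class \<open>p\<close> with label \<open>a\<close> is the set of \<open>x \<in> V\<close> with \<open>lab p x = a\<close>.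
\<close>

locale net =
  fixes V :: "'a set" and n m :: nat and lab :: "nat \<Rightarrow> 'a \<Rightarrow> nat"
  assumes finite_points: "finite V"
    and card_points: "card V = n * n"
    and two_classes: "2 \<le> m"
    and label_range: "p < m \<Longrightarrow> x \<in> V \<Longrightarrow> lab p x \<in> {1..n}"
    and lines_meet_le_1: "p < m \<Longrightarrow> q < m \<Longrightarrow> p \<noteq> q \<Longrightarrow> x \<in> V \<Longrightarrow> y \<in> V \<Longrightarrow>
      lab p x = lab p y \<Longrightarrow> lab q x = lab q y \<Longrightarrow> x = y"
begin

lemma other_class:
  obtains q where "q < m" "q \<noteq> p"
proof (cases "p = 0")
  case True
  then show thesis using that[of 1] two_classes by simp
next
  case False
  then show thesis using that[of 0] two_classes by simp
qed

text \<open>The axioms say only that lines of different classes meet at most once. The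
  \<open>n * n\<close> points thus inject into equally many pairs of labels, so every pair is
  attained and the lines do meet.\<close>

lemma bij_labels:
  assumes "p < m" "q < m" "p \<noteq> q"
  shows "bij_betw (\<lambda>x. (lab p x, lab q x)) V ({1..n} \<times> {1..n})"
proof -
  have inj: "inj_on (\<lambda>x. (lab p x, lab q x)) V"
    using lines_meet_le_1 assms by (auto simp: inj_on_def)
  moreover have "(\<lambda>x. (lab p x, lab q x)) ` V = {1..n} \<times> {1..n}"
  proof (rule card_subset_eq)
    show "(\<lambda>x. (lab p x, lab q x)) ` V \<subseteq> {1..n} \<times> {1..n}"
      using label_range assms by blast
    show "card ((\<lambda>x. (lab p x, lab q x)) ` V) = card ({1..n} \<times> {1..n})"
      by (simp add: card_image[OF inj] card_points)
  qed simp
  ultimately show ?thesis by (simp add: bij_betw_def)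
qed

lemma lines_meet:
  assumes "p < m" "q < m" "p \<noteq> q" "x \<in> V" "y \<in> V"
  obtains z where "z \<in> V" "lab p z = lab p x" "lab q z = lab q y"
proof -
  have "(lab p x, lab q y) \<in> (\<lambda>x. (lab p x, lab q x)) ` V"
    using bij_labels[OF assms(1-3)] label_range assms by (simp add: bij_betw_def)
  then show thesis using that by auto
qed

text \<open>The labels of any second class number the points of the line bijectively by
  \<open>{1..n}\<close>.\<close>

lemma card_line:
  assumes "p < m" "v \<in> V"
  shows "card {x \<in> V. lab p x = lab p v} = n"
proof -
  obtain q where q: "q < m" "q \<noteq> p"
    using other_class by metis
  let ?L = "{x \<in> V. lab p x = lab p v}"
  have "inj_on (lab q) ?L"
    using lines_meet_le_1[of p q] assms q by (auto simp: inj_on_def)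
  moreover have "lab q ` ?L = {1..n}"
  proof (intro equalityI subsetI)
    fix b assume "b \<in> {1..n}"
    then have "(lab p v, b) \<in> (\<lambda>x. (lab p x, lab q x)) ` V"
      using bij_labels[of p q] label_range[OF assms] assms q by (simp add: bij_betw_def)
    then show "b \<in> lab q ` ?L" by force
  qed (use label_range q in blast)
  ultimately show ?thesis
    by (metis card_image card_atLeastAtMost diff_Suc_1)
qed

text \<open>A cop on two lines through \<open>v\<close> would coincide with \<open>v\<close>. Each
  element of \<open>C\<close> therefore blocks at most one of the \<open>m\<close> classes.\<close>

lemma line_without_cops:
  assumes C: "C \<subseteq> V" "card C < m" and v: "v \<in> V" "v \<notin> C"
  obtains p where "p < m" "\<forall>c\<in>C. lab p c \<noteq> lab p v"
proof -
  have fin: "finite C" using C finite_points finite_subset by blast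
  let ?P = "\<lambda>c. {p. p < m \<and> lab p c = lab p v}"
  have finite_P: "finite (\<Union>c\<in>C. ?P c)" using fin by simp
  have "card (?P c) \<le> 1" if "c \<in> C" for c
    using that C v lines_meet_le_1[of _ _ c v] unfolding One_nat_def by (subst card_le_Suc0_iff_eq) auto
  then have "card (\<Union>c\<in>C. ?P c) \<le> (\<Sum>c\<in>C. 1)"
    by (intro order_trans[OF card_UN_le[OF fin]] sum_mono)
  then have "card (\<Union>c\<in>C. ?P c) < card {..<m}"
    using C by simp
  then have "\<not> {..<m} \<subseteq> (\<Union>c\<in>C. ?P c)"
    using card_mono[of "\<Union>c\<in>C. ?P c" "{..<m}"] finite_P by (meson not_le)
  then show thesis using that by blast
qed

lemma undominated_point_on_line:
  assumes C: "C \<subseteq> V" "card C * (m - 1) < n" and v: "v \<in> V"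
    and p: "p < m" "\<forall>c\<in>C. lab p c \<noteq> lab p v"
  obtains w where "w \<in> V" "lab p w = lab p v" "\<forall>c\<in>C. \<forall>q<m. lab q c \<noteq> lab q w"
proof -
  have fin: "finite C" using C finite_points finite_subset by blast
  let ?L = "{x \<in> V. lab p x = lab p v}"
  \<comment> \<open>Class \<open>p\<close> is left out because no cop is on the line of
    \<open>v\<close> in that class. Every remaining pair excludes at most one point of
    \<open>?L\<close>, which has \<open>n\<close> points.\<close>
  let ?I = "C \<times> ({..<m} - {p})"
  let ?D = "\<lambda>(c, q). {w \<in> ?L. lab q w = lab q c}"
  have finI: "finite ?I" using fin by simp
  have D: "finite (?D i) \<and> card (?D i) \<le> 1" if "i \<in> ?I" for i
  proof -
    have "finite (?D i)" using finite_points by (cases i) simp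
    then show ?thesis
      using that p lines_meet_le_1 by (cases i) (auto simp: card_le_Suc0_iff_eq)
  qed
  then have "card (\<Union>i\<in>?I. ?D i) \<le> (\<Sum>i\<in>?I. 1)"
    by (intro order_trans[OF card_UN_le[OF finI]] sum_mono) blast
  also have "\<dots> = card C * (m - 1)"
    using p by (simp add: card_cartesian_product)
  also have "\<dots> < card ?L"
    using C card_line[OF p(1) v] by simp
  finally have "\<not> ?L \<subseteq> (\<Union>i\<in>?I. ?D i)"
    using card_mono[of "\<Union>i\<in>?I. ?D i" ?L] finI D by (meson finite_UN_I not_le)
  then obtain w where w: "w \<in> ?L" "w \<notin> (\<Union>i\<in>?I. ?D i)" by blast
  have "lab q c \<noteq> lab q w" if "c \<in> C" "q < m" for c q
  proof
    assume eq: "lab q c = lab q w"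
    then have "q \<noteq> p" using that w p by force
    then have "w \<in> ?D (c, q)" using w eq by simp
    then show False using w that \<open>q \<noteq> p\<close> by blast
  qed
  then show thesis using that w by blast
qed

section \<open>The game on the collinearity graph of a net\<close>

definition collinearity_graph :: "'a pair_pre_digraph" where
  "collinearity_graph =
     \<lparr> pverts = V, parcs = {(x, y). x \<in> V \<and> y \<in> V \<and> x \<noteq> y \<and> (\<exists>p<m. lab p x = lab p y)} \<rparr>"

lemma legal_step_collinearity_graph:
  assumes "x \<in> V"
  shows "legal_step collinearity_graph x y \<longleftrightarrow> y \<in> V \<and> (\<exists>p<m. lab p x = lab p y)"
proof -
  have "\<exists>p<m. lab p x = lab p x" using two_classes by (auto intro: exI[of _ 0])
  then show ?thesis using assms by (auto simp: legal_step_def collinearity_graph_def)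
qed

lemma cops_win_collinearity_graph:
  assumes "V \<noteq> {}"
  shows "cops_win collinearity_graph m"
proof -
  obtain c where c: "c \<in> V" using assms by blast
  show ?thesis
  proof (rule cops_win_if_two_moves)
    show "length (replicate m c) = m" "set (replicate m c) \<subseteq> pverts collinearity_graph"
      using c by (auto simp: collinearity_graph_def)
    fix v assume "v \<in> pverts collinearity_graph"
    then have v: "v \<in> V" by (simp add: collinearity_graph_def)
    \<comment> \<open>All cops start at \<open>c\<close>. Cop \<open>p\<close> moves along a line
      through \<open>c\<close> of another class \<open>q\<close> to its meeting point with the class
      \<open>p\<close> line through \<open>v\<close>.\<close>
    have "\<exists>d. d \<in> V \<and> lab p d = lab p v \<and> legal_step collinearity_graph c d" if p: "p < m" for p
    proof -
      obtain q where "q < m" "p \<noteq> q"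
        using other_class by metis
      moreover from this obtain d where "d \<in> V" "lab p d = lab p v" "lab q d = lab q c"
        using lines_meet[of p q v c] p v c by blast
      ultimately show ?thesis
        using c by (auto simp: legal_step_collinearity_graph intro!: exI[of _ d] exI[of _ q])
    qed
    then obtain d where d: "\<And>p. p < m \<Longrightarrow>
        d p \<in> V \<and> lab p (d p) = lab p v \<and> legal_step collinearity_graph c (d p)"
      by metis
    have "list_all2 (legal_step collinearity_graph) (replicate m c) (map d [0..<m])"
      using d by (simp add: list_all2_conv_all_nth)
    \<comment> \<open>Any robber move, staying included, keeps his label in some class
      \<open>p\<close>, hence ends on the line held by cop \<open>p\<close>.\<close>
    moreover have "\<exists>x\<in>set (map d [0..<m]). legal_step collinearity_graph x w"
      if vw: "legal_step collinearity_graph v w" for w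
    proof -
      obtain p where "p < m" "lab p v = lab p w" "w \<in> V"
        using vw v by (auto simp: legal_step_collinearity_graph)
      then have "legal_step collinearity_graph (d p) w"
        using d by (auto simp: legal_step_collinearity_graph)
      then show ?thesis using \<open>p < m\<close> by auto
    qed
    ultimately show "\<exists>ds. list_all2 (legal_step collinearity_graph) (replicate m c) ds \<and>
        (\<forall>w. legal_step collinearity_graph v w \<longrightarrow> (\<exists>d\<in>set ds. legal_step collinearity_graph d w))"
      by blast
  qed
qed

lemma not_cops_win_collinearity_graph:
  assumes "j < m" and n: "(m - 1)\<^sup>2 < n"
  shows "\<not> cops_win collinearity_graph j"
proof (rule not_cops_win_if_escape)
  have escape: "\<exists>w. legal_step collinearity_graph v w \<and> w \<in> V \<and>
      (\<forall>c\<in>set cs. \<not> legal_step collinearity_graph c w)"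
    if cs: "length cs = j" "set cs \<subseteq> V" and v: "v \<in> V" "v \<notin> set cs" for cs v
  proof -
    have "card (set cs) < m"
      using card_length[of cs] cs assms(1) by linarith
    then obtain p where p: "p < m" "\<forall>c\<in>set cs. lab p c \<noteq> lab p v"
      using line_without_cops[OF cs(2) _ v] by blast
    have card: "card (set cs) \<le> m - 1"
      using \<open>card (set cs) < m\<close> by linarith
    have "card (set cs) * (m - 1) < n"
      using mult_le_mono1[OF card, of "m - 1"] n unfolding power2_eq_square by (rule le_less_trans)
    then obtain w where "w \<in> V" "lab p w = lab p v" "\<forall>c\<in>set cs. \<forall>q<m. lab q c \<noteq> lab q w"
      using undominated_point_on_line[OF cs(2) _ v(1) p] by blast
    then show ?thesis
      using p v cs(2) by (metis legal_step_collinearity_graph subsetD)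
  qed
  show "parcs collinearity_graph \<subseteq> pverts collinearity_graph \<times> pverts collinearity_graph"
    by (auto simp: collinearity_graph_def)
  fix cs assume cs: "length cs = j" "set cs \<subseteq> pverts collinearity_graph"
  show "\<exists>w. legal_step collinearity_graph v w \<and> (\<forall>c\<in>set cs. \<not> legal_step collinearity_graph c w)"
    if "v \<in> pverts collinearity_graph" "v \<notin> set cs" for v
    using escape[of cs v] that cs by (auto simp: collinearity_graph_def)
  \<comment> \<open>For the start, j \<le> m - 1 \<le> (m - 1)^2 < n \<le> n * n leaves a vertex
    free of cops. Escaping from it gives a vertex that no cop can reach.\<close>
  have "m - 1 \<le> (m - 1)\<^sup>2" and "n \<le> card V"
    unfolding power2_eq_square card_points by (rule le_square)+
  then have "card (set cs) < card V"
    using card_length[of cs] cs assms by linarith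
  then have "\<not> V \<subseteq> set cs"
    by (meson List.finite_set card_mono not_le)
  then show "\<exists>v\<in>pverts collinearity_graph. \<forall>c\<in>set cs. \<not> legal_step collinearity_graph c v"
    using escape[of cs] cs by (auto simp: collinearity_graph_def)
qed

lemma cop_number_collinearity_graph:
  assumes "(m - 1)\<^sup>2 < n"
  shows "cop_number collinearity_graph = m"
proof -
  have "V \<noteq> {}" using card_points assms by auto
  then show ?thesis
    unfolding cop_number_def
    using cops_win_collinearity_graph not_cops_win_collinearity_graph[OF _ assms]
    by (metis Least_equality not_le)
qed

end

section \<open>The net of a set of MOLS\<close>

text \<open>One indexed family puts rows and columns on the same footing as the squares, whose
  indices are shifted by 2.\<close>

definition cell_label :: "(nat \<Rightarrow> nat \<Rightarrow> nat \<Rightarrow> nat) \<Rightarrow> nat \<Rightarrow> nat \<times> nat \<Rightarrow> nat" where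
  "cell_label A p x =
     (if p = 0 then fst x else if p = 1 then snd x else A (p - 2) (fst x) (snd x))"

text \<open>A row and a column determine a cell. A symbol with a row or a column does so by the
  latin property, and two symbols do so by orthogonality.\<close>

lemma net_MOLS:
  assumes latin: "\<And>i. i < k \<Longrightarrow> latin_square n (A i)"
    and orth: "\<And>i j. i < k \<Longrightarrow> j < k \<Longrightarrow> i \<noteq> j \<Longrightarrow> orthogonal_squares n (A i) (A j)"
  shows "net ({1..n} \<times> {1..n}) n (k + 2) (cell_label A)"
proof
  let ?V = "{1..n} \<times> {1..n}"
  show "cell_label A p x \<in> {1..n}" if "p < k + 2" "x \<in> ?V" for p x
  proof (cases "p < 2")
    case False
    then have "latin_square n (A (p - 2))" using that latin by simp
    then show ?thesis
      using that False by (auto simp: cell_label_def latin_square_def)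
  qed (use that in \<open>auto simp: cell_label_def\<close>)
  \<comment> \<open>Ordering the classes as \<open>p < q\<close> leaves rows against columns, or
    \<open>q\<close> a square.\<close>
  have *: "x = y" if pq: "p < q" "q < k + 2" and V: "x \<in> ?V" "y \<in> ?V"
    and eq: "cell_label A p x = cell_label A p y" "cell_label A q x = cell_label A q y" for p q x y
  proof -
    obtain i j i' j' where xy: "x = (i, j)" "y = (i', j')" by (metis surj_pair)
    show ?thesis
    proof (cases "q < 2")
      case True
      then show ?thesis using pq eq xy by (auto simp: cell_label_def)
    next
      case False
      then have L: "latin_square n (A (q - 2))" and Aq: "A (q - 2) i j = A (q - 2) i' j'"
        using pq latin eq xy by (auto simp: cell_label_def)
      have sym: "A (q - 2) i j \<in> {1..n}"
        using L V xy by (auto simp: latin_square_def)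
      consider "p = 0" | "p = 1" | "p \<ge> 2" by linarith
      then show ?thesis
      proof cases
        case 1
        then have "i = i'" using eq xy by (simp add: cell_label_def)
        moreover have "\<exists>!j. j \<in> {1..n} \<and> A (q - 2) i j = A (q - 2) i' j'"
          using L sym V xy Aq unfolding latin_square_def by auto
        ultimately show ?thesis using V xy Aq by auto
      next
        case 2
        then have "j = j'" using eq xy by (simp add: cell_label_def)
        moreover have "\<exists>!i. i \<in> {1..n} \<and> A (q - 2) i j = A (q - 2) i' j'"
          using L sym V xy Aq unfolding latin_square_def by auto
        ultimately show ?thesis using V xy Aq by auto
      next
        case 3
        then have "orthogonal_squares n (A (p - 2)) (A (q - 2))"
          using orth[of "p - 2" "q - 2"] pq by simp
        moreover have "A (p - 2) i j = A (p - 2) i' j'"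
          using 3 eq xy by (simp add: cell_label_def)
        ultimately show ?thesis
          using V xy Aq inj_onD[of "\<lambda>(i, j). (A (p - 2) i j, A (q - 2) i j)" _ x y]
          by (simp add: orthogonal_squares_def)
      qed
    qed
  qed
  show "x = y" if "p < k + 2" "q < k + 2" "p \<noteq> q" "x \<in> ?V" "y \<in> ?V"
    "cell_label A p x = cell_label A p y" "cell_label A q x = cell_label A q y" for p q x y
    using *[of p q x y] *[of q p x y] that by (meson linorder_neqE_nat)
qed simp_all

lemma ex_cell_label_eq_iff:
  "(\<exists>p<k + 2. cell_label A p x = cell_label A p y) \<longleftrightarrow>
     fst x = fst y \<or> snd x = snd y \<or> (\<exists>i<k. A i (fst x) (snd x) = A i (fst y) (snd y))"
  (is "?L \<longleftrightarrow> ?R")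
proof
  assume ?L
  then obtain p where p: "p < k + 2" "cell_label A p x = cell_label A p y" by blast
  show ?R
  proof (cases "p < 2")
    case False
    then have "p - 2 < k" using p by linarith
    then show ?thesis using p False by (auto simp: cell_label_def)
  qed (use p in \<open>auto simp: cell_label_def split: if_splits\<close>)
next
  assume ?R
  then consider "fst x = fst y" | "snd x = snd y"
    | i where "i < k" "A i (fst x) (snd x) = A i (fst y) (snd y)" by blast
  then show ?L
  proof cases
    case 1
    then show ?thesis by (intro exI[of _ 0]) (simp add: cell_label_def)
  next
    case 2
    then show ?thesis by (intro exI[of _ 1]) (simp add: cell_label_def)
  next
    case 3
    then show ?thesis by (intro exI[of _ "i + 2"]) (simp add: cell_label_def)
  qed
qed

theorem theorem2p2:
  fixes k n :: nat and Ls :: "(nat \<Rightarrow> nat \<Rightarrow> nat) set"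
  assumes "k > 0" and "n > 0"
    and "n > (k + 1)^2"
    and "is_MOLS k n Ls"
  shows "cop_number (latin_square_graph n Ls) = k + 2"
proof -
  have "finite Ls" "card Ls = k"
    using assms(4) by (auto simp: is_MOLS_def)
  then obtain A where A: "bij_betw A {0..<k} Ls"
    using ex_bij_betw_nat_finite by blast
  then have range: "A ` {0..<k} = Ls" and inj: "inj_on A {0..<k}"
    by (auto simp: bij_betw_def)
  interpret net "{1..n} \<times> {1..n}" n "k + 2" "cell_label A"
  proof (rule net_MOLS)
    show "latin_square n (A i)" if "i < k" for i
      using that range assms(4) by (auto simp: is_MOLS_def)
    show "orthogonal_squares n (A i) (A j)" if "i < k" "j < k" "i \<noteq> j" for i j
    proof -
      have "A i \<in> Ls" "A j \<in> Ls" using that range by auto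
      \<comment> \<open>\<open>pairwise\<close> speaks of distinct squares, so distinct indices must
        be turned into distinct squares.\<close>
      moreover have "A i \<noteq> A j" using that inj_onD[OF inj, of i j] by auto
      ultimately show ?thesis using assms(4) by (simp add: is_MOLS_def pairwise_def)
    qed
  qed
  have "(\<exists>B\<in>Ls. B i j = B i' j') \<longleftrightarrow> (\<exists>p<k. A p i j = A p i' j')" for i j i' j'
    using range by force
  then have "latin_square_graph n Ls = collinearity_graph"
    unfolding latin_square_graph_def collinearity_graph_def ex_cell_label_eq_iff by auto
  \<comment> \<open>With \<open>m = k + 2\<close> the bound on \<open>(m - 1)\<close> squared
    becomes the hypothesis on \<open>(k + 1)\<close> squared.\<close>
  then show ?thesis
    using cop_number_collinearity_graph assms(3) by simp
qed

end
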